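(* Let $(\Omega,\mu)$ be a measure space, $\mathcal{H}_1,\mathcal{H}_2$ right quaternionic Hilbert spaces, $K_1\in\mathbb{B}(\mathcal{H}_1)$ and $K_2\in\mathbb{B}(\mathcal{H}_2)$. Let $F_1:\Omega\to\mathcal{H}_1$ be a continuous $K_1$-frame for $\mathcal{H}_1$ and $F_2:\Omega\to\mathcal{H}_2$ a continuous $K_2$-frame for $\mathcal{H}_2$, with pre-frame operators $T_1$ and $T_2$, respectively. If $F_1\oplus F_2$ is a continuous $K_1\oplus K_2$-frame for $\mathcal{H}_1\oplus\mathcal{H}_2$, then $$R(K_1)\subset T_1(N(T_2))\quad\text{and}\quad R(K_2)\subset T_2(N(T_1)).$$
   Context: $\mathbb{H}$ denotes the quaternions. A right quaternionic Hilbert space is a right $\mathbb{H}$-vector space $\mathcal{H}$ with an inner product $\langle\cdot,\cdot\rangle:\mathcal{H}\times\mathcal{H}\to\mathbb{H}$ such that $\langle u,v\rangle=\overline{\langle v,u\rangle}$, $\langle v,v\rangle>0$ for $v\neq0$, additive in the second variable with $\langle v,uq\rangle=\langle v,u\rangle q$ for $q\in\mathbb{H}$, and complete for $\|u\|=\sqrt{\langle u,u\rangle}$. $\mathbb{B}(\mathcal{H})$ is the set of bounded right $\mathbb{H}$-linear operators on $\mathcal{H}$; $L^*$, $R(L)$, $N(L)$ are the adjoint, range and kernel of $L$. $L^2(\Omega,\mathbb{H})$ is the right quaternionic Hilbert space of measurable $g:\Omega\to\mathbb{H}$ with $\int_\Omega|g|^2d\mu<\infty$ (modulo a.e. equality),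 with $\langle g,h\rangle=\int_\Omega\overline{g(\omega)}h(\omega)\,d\mu(\omega)$. For $K\in\mathbb{B}(\mathcal{H})$, a weakly measurable $F:\Omega\to\mathcal{H}$ (i.e. $\omega\mapsto\langle F(\omega),u\rangle$ is measurable for each $u$) is a continuous $K$-frame for $\mathcal{H}$ if there are $0<A\leq B<\infty$ with $A\|K^*u\|^2\leq\int_\Omega|\langle F(\omega),u\rangle|^2d\mu(\omega)\leq B\|u\|^2$ for all $u\in\mathcal{H}$. Its transform operator $\theta:\mathcal{H}\to L^2(\Omega,\mathbb{H})$ is $\theta(u)(\omega)=\langle F(\omega),u\rangle$ and its pre-frame operator is $T=\theta^*:L^2(\Omega,\mathbb{H})\to\mathcal{H}$, $Tg=\int_\Omega F(\omega)g(\omega)\,d\mu(\omega)$ (weak sense). $\mathcal{H}_1\oplus\mathcal{H}_2$ is the direct sum with inner product $\langle u_1\oplus v_1,u_2\oplus v_2\rangle=\langle u_1,u_2\rangle+\langle v_1,v_2\rangle$; $(K_1\oplus K_2)(u\oplus v)=K_1u\oplus K_2v$; $(F_1\oplus F_2)(\omega)=F_1(\omega)\oplus F_2(\omega)$. *)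

theory Defs
  imports "HOL-Analysis.Analysis"
begin

section \<open>The quaternions\<close>

datatype quat = Quat (qre: real) (qim1: real) (qim2: real) (qim3: real)

lemma quat_eq_iff: "p = q \<longleftrightarrow> qre p = qre q \<and> qim1 p = qim1 q \<and> qim2 p = qim2 q \<and> qim3 p = qim3 q"
  by (cases p; cases q) auto

instantiation quat :: real_vector
begin

definition "0 = Quat 0 0 0 0"
definition "p + q = Quat (qre p + qre q) (qim1 p + qim1 q) (qim2 p + qim2 q) (qim3 p + qim3 q)"
definition "- p = Quat (- qre p) (- qim1 p) (- qim2 p) (- qim3 p)"
definition "p - q = Quat (qre p - qre q) (qim1 p - qim1 q) (qim2 p - qim2 q) (qim3 p - qim3 q)"
definition "r *\<^sub>R p = Quat (r * qre p) (r * qim1 p) (r * qim2 p) (r * qim3 p)"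

instance
  by standard
    (auto simp: quat_eq_iff zero_quat_def plus_quat_def uminus_quat_def minus_quat_def
      scaleR_quat_def algebra_simps)

end

lemma quat_vector_sel [simp]:
  "qre 0 = 0" "qim1 0 = 0" "qim2 0 = 0" "qim3 0 = 0"
  "qre (p + q) = qre p + qre q" "qim1 (p + q) = qim1 p + qim1 q"
  "qim2 (p + q) = qim2 p + qim2 q" "qim3 (p + q) = qim3 p + qim3 q"
  "qre (- p) = - qre p" "qim1 (- p) = - qim1 p" "qim2 (- p) = - qim2 p" "qim3 (- p) = - qim3 p"
  "qre (p - q) = qre p - qre q" "qim1 (p - q) = qim1 p - qim1 q"
  "qim2 (p - q) = qim2 p - qim2 q" "qim3 (p - q) = qim3 p - qim3 q"
  "qre (r *\<^sub>R p) = r * qre p" "qim1 (r *\<^sub>R p) = r * qim1 p"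
  "qim2 (r *\<^sub>R p) = r * qim2 p" "qim3 (r *\<^sub>R p) = r * qim3 p"
  by (simp_all add: zero_quat_def plus_quat_def uminus_quat_def minus_quat_def scaleR_quat_def)

instantiation quat :: real_inner
begin

definition "inner p q = qre p * qre q + qim1 p * qim1 q + qim2 p * qim2 q + qim3 p * qim3 q"
definition "norm (p::quat) = sqrt ((qre p)\<^sup>2 + (qim1 p)\<^sup>2 + (qim2 p)\<^sup>2 + (qim3 p)\<^sup>2)"
definition "sgn (p::quat) = p /\<^sub>R norm p"
definition "dist p q = norm (p - q :: quat)"
definition [code del]:
  "(uniformity :: (quat \<times> quat) filter) = (INF e\<in>{0<..}. principal {(p, q). dist p q < e})"
definition [code del]:
  "open (U :: quat set) \<longleftrightarrow> (\<forall>p\<in>U. eventually (\<lambda>(p', q). p' = p \<longrightarrow> q \<in> U) uniformity)"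

instance
proof
  fix p q r :: quat and a :: real
  show "inner p q = inner q p" "inner (p + q) r = inner p r + inner q r"
    "inner (a *\<^sub>R p) q = a * inner p q" "0 \<le> inner p p"
    by (simp_all add: inner_quat_def algebra_simps)
  show "norm p = sqrt (inner p p)"
    by (simp add: inner_quat_def norm_quat_def power2_eq_square)
  show "inner p p = 0 \<longleftrightarrow> p = 0"
    by (simp add: inner_quat_def quat_eq_iff add_nonneg_eq_0_iff)
qed (simp_all add: sgn_quat_def dist_quat_def uniformity_quat_def open_quat_def)

end

instantiation quat :: real_normed_div_algebra
begin

definition "1 = Quat 1 0 0 0"
definition "p * q = Quat
  (qre p * qre q - qim1 p * qim1 q - qim2 p * qim2 q - qim3 p * qim3 q)
  (qre p * qim1 q + qim1 p * qre q + qim2 p * qim3 q - qim3 p * qim2 q)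
  (qre p * qim2 q - qim1 p * qim3 q + qim2 p * qre q + qim3 p * qim1 q)
  (qre p * qim3 q + qim1 p * qim2 q - qim2 p * qim1 q + qim3 p * qre q)"
definition "inverse (p::quat) = Quat (qre p) (- qim1 p) (- qim2 p) (- qim3 p) /\<^sub>R (norm p)\<^sup>2"
definition "p div (q::quat) = p * inverse q"

instance
proof
  fix p q r :: quat and a :: real
  show "p * q * r = p * (q * r)" "1 * p = p" "p * 1 = p" "(p + q) * r = p * r + q * r"
    "p * (q + r) = p * q + p * r" "a *\<^sub>R p * q = a *\<^sub>R (p * q)" "p * a *\<^sub>R q = a *\<^sub>R (p * q)"
    by (simp_all add: quat_eq_iff times_quat_def one_quat_def algebra_simps)
  show "(0::quat) \<noteq> 1"
    by (simp add: quat_eq_iff one_quat_def)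
  show "p div q = p * inverse q"
    by (rule divide_quat_def)
  show "inverse (0::quat) = 0"
    by (simp add: inverse_quat_def)
  show "norm (p * q) = norm p * norm q"
    unfolding norm_quat_def real_sqrt_mult [symmetric]
    by (rule arg_cong[where f = sqrt]) (simp add: times_quat_def power2_eq_square algebra_simps)
  assume "p \<noteq> 0"
  then have *: "(norm p)\<^sup>2 \<noteq> 0"
    by simp
  have "(norm p)\<^sup>2 = qre p * qre p + qim1 p * qim1 p + qim2 p * qim2 p + qim3 p * qim3 p"
    by (simp add: norm_quat_def power2_eq_square)
  with * show "inverse p * p = 1" "p * inverse p = 1"
    by (simp_all add: quat_eq_iff inverse_quat_def times_quat_def one_quat_def divide_simps)
qed

end

lemma quat_ring_sel [simp]:
  "qre 1 = 1" "qim1 1 = 0" "qim2 1 = 0" "qim3 1 = 0"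
  "qre (p * q) = qre p * qre q - qim1 p * qim1 q - qim2 p * qim2 q - qim3 p * qim3 q"
  "qim1 (p * q) = qre p * qim1 q + qim1 p * qre q + qim2 p * qim3 q - qim3 p * qim2 q"
  "qim2 (p * q) = qre p * qim2 q - qim1 p * qim3 q + qim2 p * qre q + qim3 p * qim1 q"
  "qim3 (p * q) = qre p * qim3 q + qim1 p * qim2 q - qim2 p * qim1 q + qim3 p * qre q"
  by (simp_all add: one_quat_def times_quat_def)

lemma quat_of_real_sel [simp]:
  "qre (of_real a) = a" "qim1 (of_real a) = 0" "qim2 (of_real a) = 0" "qim3 (of_real a) = 0"
  by (simp_all add: of_real_def)

instantiation quat :: euclidean_space
begin

definition "Basis = {1, Quat 0 1 0 0, Quat 0 0 1 0, Quat 0 0 0 1}"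

instance
proof
  fix p q :: quat
  show "(Basis :: quat set) \<noteq> {}" "finite (Basis :: quat set)"
    by (simp_all add: Basis_quat_def)
  show "inner p q = (if p = q then 1 else 0)" if "p \<in> Basis" "q \<in> Basis"
    using that unfolding Basis_quat_def insert_iff empty_iff
    by (elim disjE FalseE) (simp_all add: inner_quat_def one_quat_def)
  show "(\<forall>q\<in>Basis. inner p q = 0) \<longleftrightarrow> p = 0"
    unfolding Basis_quat_def quat_eq_iff[of p 0] by (simp add: inner_quat_def)
qed

end

definition qcnj :: "quat \<Rightarrow> quat" where
  "qcnj p = Quat (qre p) (- qim1 p) (- qim2 p) (- qim3 p)"

lemma qcnj_sel [simp]:
  "qre (qcnj p) = qre p" "qim1 (qcnj p) = - qim1 p" "qim2 (qcnj p) = - qim2 p"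
  "qim3 (qcnj p) = - qim3 p"
  by (simp_all add: qcnj_def)

lemma qcnj_mult: "qcnj (p * q) = qcnj q * qcnj p"
  by (simp add: quat_eq_iff algebra_simps)

lemma qcnj_mult_self: "qcnj p * p = of_real ((norm p)\<^sup>2)"
  by (simp add: quat_eq_iff norm_quat_def power2_eq_square algebra_simps)

lemma bounded_linear_qcnj: "bounded_linear qcnj"
  by (rule bounded_linear_intro[where K = 1]) (simp_all add: quat_eq_iff norm_quat_def)

section \<open>Right quaternionic Hilbert spaces\<close>

text \<open>
  The underlying real structure of the class (scalar multiplication, inner product, norm, topology)
  is determined by the quaternionic one: real scalars act as central quaternions, and the real
  inner product is the real part of the quaternionic one, so that the norm of \<open>u\<close> is the square
  root of the real number \<open>\<langle>u, u\<rangle>\<close>.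
\<close>

class quat_hilbert = real_inner + complete_space +
  fixes scaleH :: "'a \<Rightarrow> quat \<Rightarrow> 'a"  (infixl \<open>*\<^sub>H\<close> 75)
    and qinner :: "'a \<Rightarrow> 'a \<Rightarrow> quat"
  assumes scaleH_add_left: "(u + v) *\<^sub>H q = u *\<^sub>H q + v *\<^sub>H q"
    and scaleH_add_right: "u *\<^sub>H (p + q) = u *\<^sub>H p + u *\<^sub>H q"
    and scaleH_scaleH: "u *\<^sub>H p *\<^sub>H q = u *\<^sub>H (p * q)"
    and scaleH_one: "u *\<^sub>H 1 = u"
    and qinner_commute: "qinner u v = qcnj (qinner v u)"
    and qinner_pos: "v \<noteq> 0 \<Longrightarrow> \<exists>r>0. qinner v v = of_real r"
    and qinner_add_right: "qinner u (v + w) = qinner u v + qinner u w"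
    and qinner_scaleH_right: "qinner v (u *\<^sub>H q) = qinner v u * q"
    and scaleR_eq_scaleH: "r *\<^sub>R u = u *\<^sub>H of_real r"
    and inner_eq_qinner: "inner u v = qre (qinner u v)"

lemma qinner_self: "qinner u u = of_real ((norm u)\<^sup>2)" for u :: "'a::quat_hilbert"
proof -
  have "qre (qinner u u) = (norm u)\<^sup>2"
    using inner_eq_qinner[of u u] by (simp add: power2_norm_eq_inner)
  then show ?thesis
    using qinner_commute[of u u] by (simp add: quat_eq_iff del: of_real_power)
qed

lemma norm_eq_sqrt_qinner: "norm u = sqrt (qre (qinner u u))" for u :: "'a::quat_hilbert"
  by (simp add: qinner_self del: of_real_power)

instantiation quat :: quat_hilbert
begin

definition "(p::quat) *\<^sub>H q = p * q"
definition "qinner p (q::quat) = qcnj p * q"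

instance
proof
  fix v :: quat
  assume "v \<noteq> 0"
  then show "\<exists>r>0. qinner v v = of_real r"
    by (intro exI[of _ "(norm v)\<^sup>2"]) (simp add: qinner_quat_def qcnj_mult_self)
qed (simp_all add: scaleH_quat_def qinner_quat_def inner_quat_def quat_eq_iff algebra_simps)

end

text \<open>The direct sum.\<close>

instantiation prod :: (quat_hilbert, quat_hilbert) quat_hilbert
begin

definition "x *\<^sub>H q = (fst x *\<^sub>H q, snd x *\<^sub>H q)"
definition "qinner x y = qinner (fst x) (fst y) + qinner (snd x) (snd y)"

instance
proof
  fix u v w :: "'a \<times> 'b" and p q :: quat and r :: real
  show "(u + v) *\<^sub>H q = u *\<^sub>H q + v *\<^sub>H q" "u *\<^sub>H (p + q) = u *\<^sub>H p + u *\<^sub>H q"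
    "u *\<^sub>H p *\<^sub>H q = u *\<^sub>H (p * q)" "u *\<^sub>H 1 = u" "r *\<^sub>R u = u *\<^sub>H of_real r"
    by (simp_all add: scaleH_prod_def scaleH_add_left scaleH_add_right scaleH_scaleH scaleH_one
        scaleR_eq_scaleH prod_eq_iff)
  show "qinner u v = qcnj (qinner v u)"
    using qinner_commute[of "fst u" "fst v"] qinner_commute[of "snd u" "snd v"]
    by (simp add: qinner_prod_def quat_eq_iff)
  show "qinner u (v + w) = qinner u v + qinner u w" "qinner v (u *\<^sub>H q) = qinner v u * q"
    by (simp_all add: qinner_prod_def scaleH_prod_def qinner_add_right qinner_scaleH_right
        distrib_right)
  show "inner u v = qre (qinner u v)"
    by (simp add: qinner_prod_def inner_prod_def inner_eq_qinner)
  assume "v \<noteq> 0"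
  have "qinner v v = of_real ((norm v)\<^sup>2)"
    by (simp add: qinner_prod_def qinner_self norm_prod_def)
  with \<open>v \<noteq> 0\<close> show "\<exists>r>0. qinner v v = of_real r"
    by (intro exI[of _ "(norm v)\<^sup>2"]) simp
qed

end

definition bounded_qlinear :: "('a::quat_hilbert \<Rightarrow> 'b::quat_hilbert) \<Rightarrow> bool" where
  "bounded_qlinear L \<longleftrightarrow>
    (\<forall>u v. L (u + v) = L u + L v) \<and> (\<forall>u q. L (u *\<^sub>H q) = L u *\<^sub>H q) \<and>
    (\<exists>C. \<forall>u. norm (L u) \<le> C * norm u)"

text \<open>A bounded right linear \<open>L\<close> has exactly one adjoint, by completeness.\<close>

definition qadjoint :: "('a::quat_hilbert \<Rightarrow> 'b::quat_hilbert) \<Rightarrow> 'b \<Rightarrow> 'a" where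
  "qadjoint L = (THE L'. \<forall>u v. qinner (L' v) u = qinner v (L u))"

section \<open>The space of square integrable functions\<close>

definition square_integrable :: "'w measure \<Rightarrow> ('w \<Rightarrow> quat) set" where
  "square_integrable M =
    {g. g \<in> borel_measurable M \<and> (\<integral>\<^sup>+\<omega>. ennreal ((norm (g \<omega>))\<^sup>2) \<partial>M) < \<infinity>}"

definition ae_rel :: "'w measure \<Rightarrow> (('w \<Rightarrow> quat) \<times> ('w \<Rightarrow> quat)) set" where
  "ae_rel M = {(g, h). g \<in> square_integrable M \<and> h \<in> square_integrable M \<and>
    (AE \<omega> in M. g \<omega> = h \<omega>)}"

definition L2 :: "'w measure \<Rightarrow> ('w \<Rightarrow> quat) set set" where
  "L2 M = square_integrable M // ae_rel M"

definition L2_class :: "'w measure \<Rightarrow> ('w \<Rightarrow> quat) \<Rightarrow> ('w \<Rightarrow> quat) set" where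
  "L2_class M g = ae_rel M `` {g}"

definition L2_inner :: "'w measure \<Rightarrow> ('w \<Rightarrow> quat) set \<Rightarrow> ('w \<Rightarrow> quat) set \<Rightarrow> quat" where
  "L2_inner M G H = (THE q. \<forall>g\<in>G. \<forall>h\<in>H. q = (\<integral>\<omega>. qcnj (g \<omega>) * h \<omega> \<partial>M))"

lemma equiv_ae_rel: "equiv (square_integrable M) (ae_rel M)"
proof (rule equivI)
  show "ae_rel M \<subseteq> square_integrable M \<times> square_integrable M"
    "refl_on (square_integrable M) (ae_rel M)"
    by (auto simp: ae_rel_def refl_on_def)
  show "sym (ae_rel M)"
    by (auto simp: ae_rel_def sym_def elim!: eventually_mono)
  show "trans (ae_rel M)"
    by (auto simp: ae_rel_def trans_def elim: eventually_elim2)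
qed

lemma L2_class_in_L2: "g \<in> square_integrable M \<Longrightarrow> L2_class M g \<in> L2 M"
  by (auto simp: L2_def L2_class_def intro: quotientI)

lemma L2_class_self: "g \<in> square_integrable M \<Longrightarrow> g \<in> L2_class M g"
  by (auto simp: L2_class_def ae_rel_def)

lemma qcnj_measurable [measurable]: "qcnj \<in> borel_measurable borel"
  by (intro borel_measurable_continuous_onI linear_continuous_on bounded_linear_qcnj)

lemma integrable_qcnj_mult:
  assumes "g \<in> square_integrable M" "h \<in> square_integrable M"
  shows "integrable M (\<lambda>\<omega>. qcnj (g \<omega>) * h \<omega>)"
proof (rule Bochner_Integration.integrable_bound)
  have [measurable]: "g \<in> borel_measurable M" "h \<in> borel_measurable M"
    using assms by (auto simp: square_integrable_def)
  have "integrable M (\<lambda>\<omega>. (norm (g \<omega>))\<^sup>2)" "integrable M (\<lambda>\<omega>. (norm (h \<omega>))\<^sup>2)"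
    using assms by (auto simp: square_integrable_def integrable_iff_bounded)
  then show "integrable M (\<lambda>\<omega>. (norm (g \<omega>))\<^sup>2 + (norm (h \<omega>))\<^sup>2)"
    by simp
  show "(\<lambda>\<omega>. qcnj (g \<omega>) * h \<omega>) \<in> borel_measurable M"
    by measurable
  have "norm (qcnj p * q) \<le> (norm p)\<^sup>2 + (norm q)\<^sup>2" for p q :: quat
  proof -
    have "norm (qcnj p) = norm p"
      by (simp add: norm_quat_def)
    then have "norm (qcnj p * q) = norm p * norm q"
      by (simp add: norm_mult)
    moreover have "2 * (norm p * norm q) \<le> (norm p)\<^sup>2 + (norm q)\<^sup>2"
      using sum_squares_bound[of "norm p" "norm q"] by simp
    moreover have "0 \<le> norm p * norm q"
      by simp
    ultimately show ?thesis
      by linarith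
  qed
  then show "AE \<omega> in M. norm (qcnj (g \<omega>) * h \<omega>) \<le> norm ((norm (g \<omega>))\<^sup>2 + (norm (h \<omega>))\<^sup>2)"
    by simp
qed

lemma L2_inner_class:
  assumes g: "g \<in> square_integrable M" and h: "h \<in> square_integrable M"
  shows "L2_inner M (L2_class M g) (L2_class M h) = (\<integral>\<omega>. qcnj (g \<omega>) * h \<omega> \<partial>M)"
  unfolding L2_inner_def
proof (rule the_equality)
  show "\<forall>g'\<in>L2_class M g. \<forall>h'\<in>L2_class M h.
    (\<integral>\<omega>. qcnj (g \<omega>) * h \<omega> \<partial>M) = (\<integral>\<omega>. qcnj (g' \<omega>) * h' \<omega> \<partial>M)"
  proof (intro ballI)
    fix g' h' assume *: "g' \<in> L2_class M g" "h' \<in> L2_class M h"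
    then have "AE \<omega> in M. g \<omega> = g' \<omega>" "AE \<omega> in M. h \<omega> = h' \<omega>"
      and [measurable]: "g \<in> borel_measurable M" "g' \<in> borel_measurable M"
        "h \<in> borel_measurable M" "h' \<in> borel_measurable M"
      by (auto simp: L2_class_def ae_rel_def square_integrable_def)
    then show "(\<integral>\<omega>. qcnj (g \<omega>) * h \<omega> \<partial>M) = (\<integral>\<omega>. qcnj (g' \<omega>) * h' \<omega> \<partial>M)"
      by (intro integral_cong_AE) auto
  qed
next
  fix q assume "\<forall>g'\<in>L2_class M g. \<forall>h'\<in>L2_class M h. q = (\<integral>\<omega>. qcnj (g' \<omega>) * h' \<omega> \<partial>M)"
  from bspec[OF bspec[OF this L2_class_self[OF g]] L2_class_self[OF h]]
  show "q = (\<integral>\<omega>. qcnj (g \<omega>) * h \<omega> \<partial>M)" .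
qed

section \<open>Continuous K-frames\<close>

definition weakly_measurable :: "'w measure \<Rightarrow> ('w \<Rightarrow> 'a::quat_hilbert) \<Rightarrow> bool" where
  "weakly_measurable M F \<longleftrightarrow> (\<forall>u. (\<lambda>\<omega>. qinner (F \<omega>) u) \<in> borel_measurable M)"

definition continuous_K_frame ::
  "'w measure \<Rightarrow> ('a::quat_hilbert \<Rightarrow> 'a) \<Rightarrow> ('w \<Rightarrow> 'a) \<Rightarrow> bool" where
  "continuous_K_frame M K F \<longleftrightarrow> weakly_measurable M F \<and>
    (\<exists>A B. 0 < A \<and> A \<le> B \<and> (\<forall>u.
      ennreal (A * (norm (qadjoint K u))\<^sup>2) \<le> (\<integral>\<^sup>+\<omega>. ennreal ((norm (qinner (F \<omega>) u))\<^sup>2) \<partial>M) \<and>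
      (\<integral>\<^sup>+\<omega>. ennreal ((norm (qinner (F \<omega>) u))\<^sup>2) \<partial>M) \<le> ennreal (B * (norm u)\<^sup>2)))"

definition transform :: "'w measure \<Rightarrow> ('w \<Rightarrow> 'a::quat_hilbert) \<Rightarrow> 'a \<Rightarrow> ('w \<Rightarrow> quat) set" where
  "transform M F u = L2_class M (\<lambda>\<omega>. qinner (F \<omega>) u)"

text \<open>
  The adjoint of \<^const>\<open>transform\<close>. Written out, the defining equation is
  \<open>\<langle>T g, u\<rangle> = \<integral> (cnj g(\<omega>)) \<langle>F(\<omega>), u\<rangle> d\<mu>(\<omega>)\<close>, the weak form of \<open>T g = \<integral> F(\<omega>) g(\<omega>) d\<mu>(\<omega>)\<close>.
\<close>

definition preframe :: "'w measure \<Rightarrow> ('w \<Rightarrow> 'a::quat_hilbert) \<Rightarrow> ('w \<Rightarrow> quat) set \<Rightarrow> 'a" where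
  "preframe M F G = (THE v. \<forall>u. qinner v u = L2_inner M G (transform M F u))"

definition preframe_kernel ::
  "'w measure \<Rightarrow> ('w \<Rightarrow> 'a::quat_hilbert) \<Rightarrow> ('w \<Rightarrow> quat) set set" where
  "preframe_kernel M F = {G \<in> L2 M. preframe M F G = 0}"

end

theory Submission
  imports Defs
begin

text \<open>
  Write \<open>F = F1 \<oplus> F2\<close> and \<open>K = K1 \<oplus> K2\<close>, with transform operator \<open>\<theta>\<close> and pre-frame operator
  \<open>T\<close>. Testing against \<open>u \<oplus> 0\<close> and \<open>0 \<oplus> v\<close> shows \<open>T g = T1 g \<oplus> T2 g\<close>. The lower frame bound
  \<open>A \<parallel>K* u\<parallel>\<^sup>2 \<le> \<parallel>\<theta> u\<parallel>\<^sup>2\<close> forces \<open>R(K) \<subseteq> R(T)\<close>: this is the implication of Douglas' theorem that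
  derives range inclusion from majorization. So \<open>K1 x \<oplus> 0 = K (x \<oplus> 0)\<close> equals \<open>T1 g \<oplus> T2 g\<close> for
  some \<open>g\<close>, which says that \<open>g \<in> N(T2)\<close> and \<open>K1 x = T1 g\<close>. The other inclusion is obtained
  from \<open>0 \<oplus> y\<close>.

  For the range inclusion (lemma \<open>continuous_K_frame_range\<close>) one has to represent the functional
  \<open>u \<mapsto> \<langle>K x, u\<rangle>\<close> as \<open>u \<mapsto> \<langle>g, \<theta> u\<rangle>\<close>. The lower bound and \<open>\<langle>K x, u\<rangle> = \<langle>x, K* u\<rangle>\<close> make it bounded
  with respect to the seminorm \<open>\<parallel>\<theta> u\<parallel>\<close>, so this is the Riesz representation theorem in the closure
  of \<open>R(\<theta>)\<close>. The variational proof of that theorem splits into a part that needs no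
  completeness, namely a rapidly Cauchy minimizing sequence for a positive semidefinite form
  (\<open>riesz_minimizing_sequence\<close>), and the passage to its limit. With the inner product of a Hilbert
  space as the form, it gives the existence of adjoints (\<open>qinner_qadjoint\<close>); with
  \<open>Re \<langle>\<theta> u, \<theta> v\<rangle>\<close>, the limit \<open>g\<close> exists by the completeness of \<open>L\<^sup>2\<close>
  (\<open>L2_complete_fast_Cauchy\<close>).

  Riesz representation is carried out over the reals. A quaternion \<open>a\<close> is determined by the real
  parts of all products \<open>a q\<close>, so an identity between right linear functionals follows from that
  between their real parts (\<open>qre_mult_eqD\<close>).
\<close>

section \<open>Riesz representation without completeness\<close>

text \<open>
  The functional \<open>J v = b v v - 2 f v\<close> is bounded below because \<open>f\<close> is bounded by the seminorm
  of \<open>b\<close>. Near-minimizers of \<open>J\<close> are close to each other by the parallelogram law, and they nearly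
  satisfy the Euler-Lagrange equation \<open>b u v = f v\<close>. The geometric rate is what the limit in
  \<open>L\<^sup>2\<close> below uses for pointwise convergence.
\<close>

lemma riesz_minimizing_sequence:
  fixes b :: "'v::real_vector \<Rightarrow> 'v \<Rightarrow> real" and f :: "'v \<Rightarrow> real"
  assumes b: "bilinear b" and sym: "\<And>u v. b u v = b v u" and nonneg: "\<And>u. 0 \<le> b u u"
    and f: "linear f" and "0 \<le> C" and bound: "\<And>v. (f v)\<^sup>2 \<le> C * b v v"
  obtains u :: "nat \<Rightarrow> 'v"
  where "\<And>m n. m \<le> n \<Longrightarrow> b (u m - u n) (u m - u n) \<le> (1/4) ^ m"
    and "\<And>v. (\<lambda>n. b (u n) v) \<longlonglongrightarrow> f v"
proof -
  note bl = bilinear_ladd[OF b] bilinear_radd[OF b] bilinear_lmul[OF b] bilinear_rmul[OF b]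
    bilinear_lsub[OF b] bilinear_rsub[OF b]
  note fl = linear_add[OF f] linear_diff[OF f] linear_scale[OF f]
  define J where "J v = b v v - 2 * f v" for v
  have "- (C + 1) \<le> J v" for v
  proof -
    \<comment> \<open>The shift by 1 allows division by the constant also when \<open>C = 0\<close>.\<close>
    define D where "D = C + 1"
    have "D > 0"
      using \<open>0 \<le> C\<close> by (simp add: D_def)
    have "(f v)\<^sup>2 \<le> D * b v v"
      using bound[of v] nonneg[of v] by (simp add: D_def algebra_simps)
    then have "(f v)\<^sup>2 / D \<le> b v v"
      using \<open>D > 0\<close> by (simp add: field_simps)
    moreover have "0 \<le> (f v - D)\<^sup>2 / D"
      using \<open>D > 0\<close> by simp
    moreover have "(f v - D)\<^sup>2 / D = (f v)\<^sup>2 / D - 2 * f v + D"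
      using \<open>D > 0\<close> by (simp add: power2_eq_square field_simps)
    ultimately show ?thesis
      unfolding J_def D_def[symmetric] by linarith
  qed
  then have bdd: "bdd_below (range J)"
    by (intro bdd_belowI[of _ "- (C + 1)"]) auto
  define m where "m = Inf (range J)"
  have m_le: "m \<le> J v" for v
    unfolding m_def by (rule cInf_lower[OF _ bdd]) simp
  define e :: "nat \<Rightarrow> real" where "e n = (1/4) ^ n / 4" for n
  have "\<exists>v. J v < m + e n" for n
  proof -
    have "m < m + e n"
      by (simp add: e_def)
    then show ?thesis
      using cInf_less_iff[OF _ bdd, of "m + e n"] by (auto simp: m_def)
  qed
  then obtain u where u: "\<And>n. J (u n) < m + e n"
    by metis
  show thesis
  proof (rule that)
    fix k n :: nat assume "k \<le> n"
    define w where "w = (1/2) *\<^sub>R (u k + u n)"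
    have "b (u k - u n) (u k - u n) = 2 * J (u k) + 2 * J (u n) - 4 * J w"
      by (simp add: J_def w_def bl fl sym[of "u n" "u k"] field_simps)
    also have "\<dots> \<le> 2 * e k + 2 * e n"
      using u[of k] u[of n] m_le[of w] by linarith
    also have "e n \<le> e k"
      unfolding e_def using \<open>k \<le> n\<close> by (simp add: power_decreasing)
    finally show "b (u k - u n) (u k - u n) \<le> (1/4) ^ k"
      by (simp add: e_def)
  next
    fix v
    have *: "(b (u n) v - f v)\<^sup>2 \<le> e n * (b v v + 1)" for n
    proof -
      define c where "c = b (u n) v - f v"
      \<comment> \<open>The minimizer of \<open>2 t c + t\<^sup>2 (b v v + 1)\<close>; the 1 covers degenerate \<open>v\<close>, where
        \<open>b v v = 0\<close>.\<close>
      define t where "t = - c / (b v v + 1)"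
      have p: "b v v + 1 > 0"
        using nonneg[of v] by simp
      have "J (u n + t *\<^sub>R v) = J (u n) + 2 * t * c + t\<^sup>2 * b v v"
        by (simp add: J_def c_def bl fl sym[of v "u n"] power2_eq_square algebra_simps)
      also have "\<dots> \<le> J (u n) + 2 * t * c + t\<^sup>2 * (b v v + 1)"
        by (simp add: algebra_simps)
      finally have "J (u n + t *\<^sub>R v) \<le> J (u n) + 2 * t * c + t\<^sup>2 * (b v v + 1)" .
      moreover have "2 * t * c + t\<^sup>2 * (b v v + 1) = - (c\<^sup>2 / (b v v + 1))"
        using p by (simp add: t_def power2_eq_square divide_simps)
      ultimately have "c\<^sup>2 / (b v v + 1) \<le> e n"
        using u[of n] m_le[of "u n + t *\<^sub>R v"] by linarith
      then show ?thesis
        using p by (simp add: c_def field_simps)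
    qed
    have "(\<lambda>n. e n * (b v v + 1)) \<longlonglongrightarrow> 0 / 4 * (b v v + 1)"
      unfolding e_def by (intro tendsto_intros LIMSEQ_realpow_zero) auto
    then have "(\<lambda>n. e n * (b v v + 1)) \<longlonglongrightarrow> 0"
      by (simp only: div_0 mult_zero_left)
    then have "(\<lambda>n. (b (u n) v - f v)\<^sup>2) \<longlonglongrightarrow> 0"
      by (rule tendsto_sandwich[rotated 2, OF tendsto_const]) (use * in \<open>simp_all add: always_eventually\<close>)
    then have "(\<lambda>n. b (u n) v - f v) \<longlonglongrightarrow> 0"
      by simp
    then show "(\<lambda>n. b (u n) v) \<longlonglongrightarrow> f v"
      by (rule LIM_zero_cancel)
  qed
qed

section \<open>Limits of square integrable functions\<close>

text \<open>
  The weighted series \<open>\<Sum>n. 2 ^ n * |g (n+1) - g n|\<^sup>2\<close> has finite integral, hence is finite almost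
  everywhere. By the inequality between arithmetic and geometric means the increments are then
  absolutely summable, so \<open>g\<close> converges almost everywhere, and Fatou's lemma transfers the rate
  to the limit.
\<close>
lemma L2_complete_fast_Cauchy:
  fixes g :: "nat \<Rightarrow> 'w \<Rightarrow> 'b::{banach, second_countable_topology}"
  assumes [measurable]: "\<And>n. g n \<in> borel_measurable M"
    and fast: "\<And>m n. m \<le> n \<Longrightarrow>
      (\<integral>\<^sup>+\<omega>. ennreal ((norm (g m \<omega> - g n \<omega>))\<^sup>2) \<partial>M) \<le> ennreal ((1/4) ^ m)"
  obtains h where "h \<in> borel_measurable M"
    and "\<And>n. (\<integral>\<^sup>+\<omega>. ennreal ((norm (g n \<omega> - h \<omega>))\<^sup>2) \<partial>M) \<le> ennreal ((1/4) ^ n)"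
proof -
  define d where "d n \<omega> = norm (g (Suc n) \<omega> - g n \<omega>)" for n \<omega>
  define h where "h \<omega> = lim (\<lambda>n. g n \<omega>)" for \<omega>
  have [measurable]: "d n \<in> borel_measurable M" for n
    unfolding d_def by measurable
  have h [measurable]: "h \<in> borel_measurable M"
    unfolding h_def by measurable
  have "(\<integral>\<^sup>+\<omega>. (\<Sum>n. ennreal (2 ^ n * (d n \<omega>)\<^sup>2)) \<partial>M)
      = (\<Sum>n. \<integral>\<^sup>+\<omega>. ennreal (2 ^ n * (d n \<omega>)\<^sup>2) \<partial>M)"
    by (rule nn_integral_suminf) measurable
  also have "\<dots> \<le> (\<Sum>n. ennreal ((1/2) ^ n))"
  proof (rule suminf_le)
    fix n
    have "(\<integral>\<^sup>+\<omega>. ennreal (2 ^ n * (d n \<omega>)\<^sup>2) \<partial>M) = ennreal (2 ^ n) * (\<integral>\<^sup>+\<omega>. ennreal ((d n \<omega>)\<^sup>2) \<partial>M)"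
      by (simp add: ennreal_mult nn_integral_cmult)
    also have "\<dots> \<le> ennreal (2 ^ n) * ennreal ((1/4) ^ n)"
      using fast[of n "Suc n"] by (intro mult_left_mono) (auto simp: d_def norm_minus_commute)
    also have "\<dots> = ennreal ((1/2) ^ n)"
      by (simp add: ennreal_mult[symmetric] power_mult_distrib[symmetric])
    finally show "(\<integral>\<^sup>+\<omega>. ennreal (2 ^ n * (d n \<omega>)\<^sup>2) \<partial>M) \<le> ennreal ((1/2) ^ n)" .
  qed auto
  also have "\<dots> = ennreal (\<Sum>n. (1/2) ^ n)"
    by (intro suminf_ennreal2 summable_geometric) auto
  also have "\<dots> < \<infinity>"
    by simp
  finally have "AE \<omega> in M. (\<Sum>n. ennreal (2 ^ n * (d n \<omega>)\<^sup>2)) \<noteq> \<infinity>"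
    by (intro nn_integral_noteq_infinite) auto
  then have lim: "AE \<omega> in M. (\<lambda>n. g n \<omega>) \<longlonglongrightarrow> h \<omega>"
  proof eventually_elim
    fix \<omega> assume "(\<Sum>n. ennreal (2 ^ n * (d n \<omega>)\<^sup>2)) \<noteq> \<infinity>"
    then have "summable (\<lambda>n. 2 ^ n * (d n \<omega>)\<^sup>2)"
      by (intro summable_suminf_not_top) auto
    then have dom: "summable (\<lambda>n. 2 ^ n * (d n \<omega>)\<^sup>2 + (1/2) ^ n)"
      by (intro summable_add summable_geometric) auto
    have le: "norm (g (Suc n) \<omega> - g n \<omega>) \<le> 2 ^ n * (d n \<omega>)\<^sup>2 + (1/2) ^ n" for n
    proof -
      define s :: real where "s = 2 ^ n"
      have "s > 0" by (simp add: s_def)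
      have "0 \<le> (s * d n \<omega> - 1)\<^sup>2 / s" "0 \<le> d n \<omega>"
        using \<open>s > 0\<close> by (simp_all add: d_def)
      moreover have "(s * d n \<omega> - 1)\<^sup>2 / s = s * (d n \<omega>)\<^sup>2 + 1 / s - 2 * d n \<omega>"
        using \<open>s > 0\<close> by (simp add: power2_eq_square field_simps)
      ultimately have "d n \<omega> \<le> s * (d n \<omega>)\<^sup>2 + 1 / s"
        by linarith
      then show ?thesis
        by (simp add: d_def s_def power_one_over)
    qed
    have "summable (\<lambda>n. g (Suc n) \<omega> - g n \<omega>)"
      by (rule summable_comparison_test'[where N = 0, OF dom le])
    then have "convergent (\<lambda>n. \<Sum>i<n. g (Suc i) \<omega> - g i \<omega>)"
      by (simp add: summable_iff_convergent)
    then have "convergent (\<lambda>n. g n \<omega> - g 0 \<omega>)"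
      unfolding sum_lessThan_telescope[of "\<lambda>n. g n \<omega>"] .
    from convergent_add[OF this convergent_const[of "g 0 \<omega>"]]
    have "convergent (\<lambda>n. g n \<omega>)"
      by simp
    then show "(\<lambda>n. g n \<omega>) \<longlonglongrightarrow> h \<omega>"
      by (simp add: h_def convergent_LIMSEQ_iff)
  qed
  show thesis
  proof (rule that[OF h])
    fix n
    have "(\<integral>\<^sup>+\<omega>. ennreal ((norm (g n \<omega> - h \<omega>))\<^sup>2) \<partial>M)
        = (\<integral>\<^sup>+\<omega>. liminf (\<lambda>k. ennreal ((norm (g n \<omega> - g k \<omega>))\<^sup>2)) \<partial>M)"
    proof (rule nn_integral_cong_AE)
      show "AE \<omega> in M. ennreal ((norm (g n \<omega> - h \<omega>))\<^sup>2)
          = liminf (\<lambda>k. ennreal ((norm (g n \<omega> - g k \<omega>))\<^sup>2))"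
        using lim
      proof eventually_elim
        fix \<omega> assume "(\<lambda>k. g k \<omega>) \<longlonglongrightarrow> h \<omega>"
        then have "(\<lambda>k. ennreal ((norm (g n \<omega> - g k \<omega>))\<^sup>2)) \<longlonglongrightarrow> ennreal ((norm (g n \<omega> - h \<omega>))\<^sup>2)"
          by (intro tendsto_intros)
        then show "ennreal ((norm (g n \<omega> - h \<omega>))\<^sup>2) = liminf (\<lambda>k. ennreal ((norm (g n \<omega> - g k \<omega>))\<^sup>2))"
          by (rule lim_imp_Liminf[OF sequentially_bot, symmetric])
      qed
    qed
    also have "\<dots> \<le> liminf (\<lambda>k. \<integral>\<^sup>+\<omega>. ennreal ((norm (g n \<omega> - g k \<omega>))\<^sup>2) \<partial>M)"
      by (rule nn_integral_liminf) measurable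
    also have "\<dots> \<le> ennreal ((1/4) ^ n)"
    proof (rule order_trans[OF Liminf_le_Limsup])
      show "limsup (\<lambda>k. \<integral>\<^sup>+\<omega>. ennreal ((norm (g n \<omega> - g k \<omega>))\<^sup>2) \<partial>M) \<le> ennreal ((1/4) ^ n)"
        using fast[of n] by (intro Limsup_bounded) (auto simp: eventually_sequentially)
    qed simp
    finally show "(\<integral>\<^sup>+\<omega>. ennreal ((norm (g n \<omega> - h \<omega>))\<^sup>2) \<partial>M) \<le> ennreal ((1/4) ^ n)" .
  qed
qed

lemma square_integrableD: "g \<in> square_integrable M \<Longrightarrow> g \<in> borel_measurable M"
  by (simp add: square_integrable_def)

lemma qre_qcnj_mult: "qre (qcnj p * q) = inner p q"
  by (simp add: inner_quat_def)

lemma integrable_inner: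
  assumes "g \<in> square_integrable M" "h \<in> square_integrable M"
  shows "integrable M (\<lambda>\<omega>. inner (g \<omega>) (h \<omega>))"
    and "qre (\<integral>\<omega>. qcnj (g \<omega>) * h \<omega> \<partial>M) = (\<integral>\<omega>. inner (g \<omega>) (h \<omega>) \<partial>M)"
proof -
  have "qre = (\<lambda>p. inner p 1)"
    by (auto simp: inner_quat_def)
  then have "bounded_linear qre"
    using bounded_linear_inner_left[of "1::quat"] by metis
  from integrable_bounded_linear[OF this integrable_qcnj_mult[OF assms]]
    integral_bounded_linear[OF this integrable_qcnj_mult[OF assms]]
  show "integrable M (\<lambda>\<omega>. inner (g \<omega>) (h \<omega>))"
    and "qre (\<integral>\<omega>. qcnj (g \<omega>) * h \<omega> \<partial>M) = (\<integral>\<omega>. inner (g \<omega>) (h \<omega>) \<partial>M)"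
    by (simp_all only: qre_qcnj_mult)
qed

lemma square_integrable_add:
  assumes "g \<in> square_integrable M" "h \<in> square_integrable M"
  shows "(\<lambda>\<omega>. g \<omega> + h \<omega>) \<in> square_integrable M"
proof -
  have [measurable]: "g \<in> borel_measurable M" "h \<in> borel_measurable M"
    using assms by (auto simp: square_integrable_def)
  have "(\<integral>\<^sup>+\<omega>. ennreal ((norm (g \<omega> + h \<omega>))\<^sup>2) \<partial>M)
      \<le> (\<integral>\<^sup>+\<omega>. 2 * ennreal ((norm (g \<omega>))\<^sup>2) + 2 * ennreal ((norm (h \<omega>))\<^sup>2) \<partial>M)"
  proof (rule nn_integral_mono)
    fix \<omega>
    have "(norm (g \<omega> + h \<omega>))\<^sup>2 \<le> (norm (g \<omega>) + norm (h \<omega>))\<^sup>2"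
      by (intro power_mono norm_triangle_ineq) simp
    also have "\<dots> \<le> 2 * (norm (g \<omega>))\<^sup>2 + 2 * (norm (h \<omega>))\<^sup>2"
      using sum_squares_bound[of "norm (g \<omega>)" "norm (h \<omega>)"]
      by (simp add: power2_sum)
    finally show "ennreal ((norm (g \<omega> + h \<omega>))\<^sup>2)
        \<le> 2 * ennreal ((norm (g \<omega>))\<^sup>2) + 2 * ennreal ((norm (h \<omega>))\<^sup>2)"
      by (simp add: ennreal_mult[symmetric] ennreal_plus[symmetric] flip: ennreal_numeral del: ennreal_plus)
  qed
  also have "\<dots> < \<infinity>"
    using assms by (simp add: nn_integral_add nn_integral_cmult square_integrable_def ennreal_mult_less_top)
  finally show ?thesis
    by (simp add: square_integrable_def)
qed

text \<open>
  By the Cauchy-Schwarz inequality, the inner product with a fixed \<open>w\<close> is continuous for the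
  \<open>L\<^sup>2\<close> norm.
\<close>
lemma tendsto_integral_inner:
  assumes g: "\<And>n. g n \<in> square_integrable M" and h: "h \<in> square_integrable M"
    and w: "w \<in> square_integrable M"
    and le: "\<And>n. (\<integral>\<^sup>+\<omega>. ennreal ((norm (g n \<omega> - h \<omega>))\<^sup>2) \<partial>M) \<le> ennreal (e n)"
    and e: "\<And>n. 0 \<le> e n" "e \<longlonglongrightarrow> 0"
  shows "(\<lambda>n. \<integral>\<omega>. inner (g n \<omega>) (w \<omega>) \<partial>M) \<longlonglongrightarrow> (\<integral>\<omega>. inner (h \<omega>) (w \<omega>) \<partial>M)"
proof (rule LIM_zero_cancel)
  have [measurable]: "g n \<in> borel_measurable M" "h \<in> borel_measurable M" "w \<in> borel_measurable M" for n
    by (intro square_integrableD g h w)+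
  obtain r where r: "(\<integral>\<^sup>+\<omega>. ennreal ((norm (w \<omega>))\<^sup>2) \<partial>M) = ennreal r" "0 \<le> r"
    using w by (cases "\<integral>\<^sup>+\<omega>. ennreal ((norm (w \<omega>))\<^sup>2) \<partial>M") (auto simp: square_integrable_def)
  let ?D = "\<lambda>n. (\<integral>\<omega>. inner (g n \<omega>) (w \<omega>) \<partial>M) - (\<integral>\<omega>. inner (h \<omega>) (w \<omega>) \<partial>M)"
  have D: "(?D n)\<^sup>2 \<le> e n * r" for n
  proof -
    have int: "integrable M (\<lambda>\<omega>. inner (g n \<omega> - h \<omega>) (w \<omega>))"
      using integrable_inner(1)[OF g w] integrable_inner(1)[OF h w] by (simp add: inner_diff_left)
    have "?D n = (\<integral>\<omega>. inner (g n \<omega> - h \<omega>) (w \<omega>) \<partial>M)"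
      using integrable_inner(1)[OF g w] integrable_inner(1)[OF h w] by (simp add: inner_diff_left)
    then have "ennreal (norm (?D n)) \<le> (\<integral>\<^sup>+\<omega>. ennreal (norm (inner (g n \<omega> - h \<omega>) (w \<omega>))) \<partial>M)"
      using integral_norm_bound_ennreal[OF int] by simp
    also have "\<dots> \<le> (\<integral>\<^sup>+\<omega>. ennreal (norm (g n \<omega> - h \<omega>)) * ennreal (norm (w \<omega>)) \<partial>M)"
      by (intro nn_integral_mono)
        (simp add: ennreal_mult[symmetric] Cauchy_Schwarz_ineq2)
    finally have "(ennreal (norm (?D n)))\<^sup>2
        \<le> (\<integral>\<^sup>+\<omega>. ennreal (norm (g n \<omega> - h \<omega>)) * ennreal (norm (w \<omega>)) \<partial>M)\<^sup>2"
      by (intro power_mono) auto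
    also have "\<dots> \<le> (\<integral>\<^sup>+\<omega>. (ennreal (norm (g n \<omega> - h \<omega>)))\<^sup>2 \<partial>M) * (\<integral>\<^sup>+\<omega>. (ennreal (norm (w \<omega>)))\<^sup>2 \<partial>M)"
      by (rule Cauchy_Schwarz_nn_integral) measurable
    also have "\<dots> = (\<integral>\<^sup>+\<omega>. ennreal ((norm (g n \<omega> - h \<omega>))\<^sup>2) \<partial>M) * ennreal r"
      by (simp add: ennreal_power r)
    also have "\<dots> \<le> ennreal (e n) * ennreal r"
      by (intro mult_right_mono le) simp
    also have "\<dots> = ennreal (e n * r)"
      using e(1) r(2) by (simp add: ennreal_mult)
    finally have "ennreal ((norm (?D n))\<^sup>2) \<le> ennreal (e n * r)"
      by (simp add: ennreal_power)
    then show ?thesis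
      using e(1)[of n] r(2) by (simp add: ennreal_le_iff)
  qed
  have "(\<lambda>n. e n * r) \<longlonglongrightarrow> 0"
    using tendsto_mult_right[OF e(2), of r] by simp
  then have "(\<lambda>n. (?D n)\<^sup>2) \<longlonglongrightarrow> 0"
    by (rule tendsto_sandwich[rotated 2, OF tendsto_const])
      (use D in \<open>simp_all add: always_eventually\<close>)
  then show "?D \<longlonglongrightarrow> 0"
    by simp
qed

section \<open>Adjoints of bounded right linear operators\<close>

text \<open>
  Multiplication on the right by \<open>1\<close>, \<open>i\<close>, \<open>j\<close>, \<open>k\<close> moves each of the four coordinates of \<open>a\<close>, up to
  sign, into the real part.
\<close>
lemma qre_mult_eqD:
  assumes "\<And>q. qre (a * q) = qre (b * q)"
  shows "a = b"
  using assms[of 1] assms[of "Quat 0 1 0 0"] assms[of "Quat 0 0 1 0"] assms[of "Quat 0 0 0 1"]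
  by (simp add: quat_eq_iff)

lemma qinner_0_left [simp]: "qinner (0::'a::quat_hilbert) u = 0"
  and qinner_0_right [simp]: "qinner u (0::'a::quat_hilbert) = 0"
proof -
  show *: "qinner u (0::'a) = 0" for u :: 'a
    using qinner_add_right[of u 0 0] by simp
  show "qinner (0::'a) u = 0"
    using qinner_commute[of 0 u] * by (simp add: quat_eq_iff)
qed

lemma qinner_left_unique:
  fixes v w :: "'a::quat_hilbert"
  assumes "\<And>u. qinner v u = qinner w u"
  shows "v = w"
proof -
  have "inner (v - w) (v - w) = 0"
    using assms[of "v - w"] unfolding inner_diff_left by (simp add: inner_eq_qinner)
  then show ?thesis
    by simp
qed

lemma qinner_scaleR_right: "qinner v (r *\<^sub>R u) = r *\<^sub>R qinner v u" for u v :: "'a::quat_hilbert"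
  by (simp add: scaleR_eq_scaleH[of r u] qinner_scaleH_right quat_eq_iff)

lemma bounded_qlinear_imp_linear:
  assumes "bounded_qlinear K"
  shows "linear K"
  using assms by (auto simp: bounded_qlinear_def scaleR_eq_scaleH intro!: linearI)

lemma riesz_representation_real:
  fixes f :: "'a::{real_inner, complete_space} \<Rightarrow> real"
  assumes "linear f" "0 \<le> C" "\<And>v. \<bar>f v\<bar> \<le> C * norm v"
  obtains w where "\<And>v. inner w v = f v"
proof -
  have bound: "(f v)\<^sup>2 \<le> C\<^sup>2 * inner v v" for v
    using power_mono[OF assms(3)[of v], of 2]
    by (simp add: power_mult_distrib power2_norm_eq_inner)
  have bil: "bilinear (inner :: 'a \<Rightarrow> 'a \<Rightarrow> real)"
    by (simp add: bilinear_def linear_iff inner_add_left inner_add_right)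
  obtain u :: "nat \<Rightarrow> 'a"
    where u: "\<And>m n. m \<le> n \<Longrightarrow> inner (u m - u n) (u m - u n) \<le> (1/4) ^ m"
      "\<And>v. (\<lambda>n. inner (u n) v) \<longlonglongrightarrow> f v"
    using riesz_minimizing_sequence[OF bil inner_commute inner_ge_zero assms(1) zero_le_power2 bound] by blast
  have d: "dist (u m) (u n) \<le> (1/2) ^ m" if "m \<le> n" for m n
  proof -
    have "((1/2) ^ m)\<^sup>2 = ((1/4) ^ m :: real)"
      by (simp add: power2_eq_square flip: power_mult_distrib)
    then have "(norm (u m - u n))\<^sup>2 \<le> ((1/2) ^ m)\<^sup>2"
      using u(1)[OF that] by (simp add: power2_norm_eq_inner)
    then show ?thesis
      unfolding dist_norm by (rule power2_le_imp_le) simp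
  qed
  have "Cauchy u"
    unfolding Cauchy_altdef
  proof (intro allI impI)
    fix e :: real assume "0 < e"
    then obtain N where N: "(1/2) ^ N < e"
      using real_arch_pow_inv[of e "1/2"] by auto
    show "\<exists>N. \<forall>m\<ge>N. \<forall>n>m. dist (u m) (u n) < e"
    proof (intro exI allI impI)
      fix m n assume "N \<le> m" "m < n"
      have "dist (u m) (u n) \<le> (1/2) ^ m"
        using d \<open>m < n\<close> by simp
      also have "\<dots> \<le> (1/2) ^ N"
        using \<open>N \<le> m\<close> by (intro power_decreasing) auto
      finally show "dist (u m) (u n) < e"
        using N by simp
    qed
  qed
  then obtain w where "u \<longlonglongrightarrow> w"
    using Cauchy_convergent convergent_def by blast
  then have "(\<lambda>n. inner (u n) v) \<longlonglongrightarrow> inner w v" for v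
    by (intro tendsto_intros)
  then show thesis
    using that u(2) LIMSEQ_unique by blast
qed

text \<open>
  The defining description of \<^const>\<open>qadjoint\<close> picks out something only once an adjoint is known
  to exist. The real Riesz theorem yields \<open>w\<close> with \<open>Re \<langle>w, u\<rangle> = Re \<langle>v, K u\<rangle>\<close> for all \<open>u\<close>;
  replacing \<open>u\<close> by \<open>u q\<close> removes the real parts.
\<close>
lemma qinner_qadjoint:
  fixes K :: "'a::quat_hilbert \<Rightarrow> 'b::quat_hilbert"
  assumes K: "bounded_qlinear K"
  shows "qinner (qadjoint K v) u = qinner v (K u)"
proof -
  obtain C where "norm (K u) \<le> C * norm u" for u
    using K by (auto simp: bounded_qlinear_def)
  then have C: "norm (K u) \<le> max C 0 * norm u" for u
    by (meson max.cobounded1 mult_right_mono norm_ge_zero order_trans)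
  have "\<exists>w. \<forall>u. qinner w u = qinner v (K u)" for v
  proof -
    have "linear (\<lambda>u. inner v (K u))"
      using bounded_qlinear_imp_linear[OF K] by (simp add: linear_iff inner_add_right)
    moreover have "\<bar>inner v (K u)\<bar> \<le> norm v * max C 0 * norm u" for u
    proof -
      have "\<bar>inner v (K u)\<bar> \<le> norm v * norm (K u)"
        by (rule Cauchy_Schwarz_ineq2)
      also have "\<dots> \<le> norm v * (max C 0 * norm u)"
        by (intro mult_left_mono C) simp
      finally show ?thesis
        by (simp add: mult.assoc)
    qed
    ultimately obtain w where w: "\<And>u. inner w u = inner v (K u)"
      using riesz_representation_real[of "\<lambda>u. inner v (K u)" "norm v * max C 0"] by auto
    have "qinner w u = qinner v (K u)" for u
    proof (rule qre_mult_eqD)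
      fix q
      show "qre (qinner w u * q) = qre (qinner v (K u) * q)"
        using w[of "u *\<^sub>H q"] K
        by (simp add: inner_eq_qinner qinner_scaleH_right bounded_qlinear_def del: quat_ring_sel)
    qed
    then show ?thesis
      by blast
  qed
  then obtain L where L: "\<forall>u v. qinner (L v) u = qinner v (K u)"
    by metis
  have "qadjoint K = L"
    unfolding qadjoint_def
  proof (rule the_equality[of "\<lambda>L'. \<forall>u v. qinner (L' v) u = qinner v (K u)", OF L])
    fix L' assume "\<forall>u v. qinner (L' v) u = qinner v (K u)"
    with L have "qinner (L' v) u = qinner (L v) u" for u v
      by simp
    then show "L' = L"
      by (rule ext[OF qinner_left_unique])
  qed
  with L show ?thesis
    by simp
qed

section \<open>The range of \<open>K\<close> lies in the range of the pre-frame operator\<close>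

lemma preframe_eqI:
  assumes "\<And>u. qinner v u = L2_inner M G (transform M F u)"
  shows "preframe M F G = v"
  unfolding preframe_def
proof (rule the_equality)
  fix w assume "\<forall>u. qinner w u = L2_inner M G (transform M F u)"
  with assms have "qinner w u = qinner v u" for u
    by simp
  then show "w = v"
    by (rule qinner_left_unique)
qed (simp add: assms)

text \<open>
  The functional \<open>v \<mapsto> Re \<langle>K x, v\<rangle> = Re \<langle>x, K* v\<rangle>\<close> is bounded by \<open>\<parallel>x\<parallel> \<parallel>\<theta> v\<parallel> / \<surd>A\<close>. A minimizing
  sequence \<open>u\<close> for the form \<open>Re \<langle>\<theta> u, \<theta> v\<rangle>\<close> need not converge in the Hilbert space, since \<open>\<theta>\<close>
  need not be bounded below, but \<open>\<theta> (u n)\<close> converges in \<open>L\<^sup>2\<close>, and the limit represents the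
  functional.
\<close>
lemma continuous_K_frame_range:
  fixes K :: "'a::quat_hilbert \<Rightarrow> 'a"
  assumes K: "bounded_qlinear K" and F: "continuous_K_frame M K F"
  obtains G where "G \<in> L2 M" "\<And>u. qinner (K x) u = L2_inner M G (transform M F u)"
proof -
  let ?t = "\<lambda>u \<omega>. qinner (F \<omega>) u"
  obtain A B where AB: "0 < A"
      "\<And>u. ennreal (A * (norm (qadjoint K u))\<^sup>2) \<le> (\<integral>\<^sup>+\<omega>. ennreal ((norm (?t u \<omega>))\<^sup>2) \<partial>M)"
      "\<And>u. (\<integral>\<^sup>+\<omega>. ennreal ((norm (?t u \<omega>))\<^sup>2) \<partial>M) \<le> ennreal (B * (norm u)\<^sup>2)"
    and [measurable]: "\<And>u. ?t u \<in> borel_measurable M"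
    using F by (auto simp: continuous_K_frame_def weakly_measurable_def)
  have sq: "?t u \<in> square_integrable M" for u
    using AB(3)[of u] by (auto simp: square_integrable_def intro: le_less_trans)
  note int = integrable_inner(1)[OF sq sq]
  have t_lin: "?t (u + v) \<omega> = ?t u \<omega> + ?t v \<omega>" "?t (r *\<^sub>R u) \<omega> = r *\<^sub>R ?t u \<omega>" for u v r \<omega>
    by (simp_all add: qinner_add_right qinner_scaleR_right)
  have t_diff: "?t (u - v) \<omega> = ?t u \<omega> - ?t v \<omega>" for u v \<omega>
    using t_lin(1)[of \<omega> "u - v" v] by (simp add: algebra_simps)
  define b where "b u v = (\<integral>\<omega>. inner (?t u \<omega>) (?t v \<omega>) \<partial>M)" for u v
  have "bilinear b"
    unfolding bilinear_def linear_iff b_def t_lin inner_add_left inner_add_right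
      inner_scaleR_left inner_scaleR_right using int by simp
  have b_nn: "(\<integral>\<^sup>+\<omega>. ennreal ((norm (?t u \<omega>))\<^sup>2) \<partial>M) = ennreal (b u u)" for u
    unfolding b_def power2_norm_eq_inner by (intro nn_integral_eq_integral int) auto
  have b_nonneg: "0 \<le> b u u" for u
    unfolding b_def by (intro integral_nonneg_AE) auto
  have bound: "(inner (K x) v)\<^sup>2 \<le> ((norm x)\<^sup>2 / A) * b v v" for v
  proof -
    have "inner v (K x) = inner (qadjoint K v) x"
      unfolding inner_eq_qinner qinner_qadjoint[OF K] ..
    then have "inner (K x) v = inner x (qadjoint K v)"
      by (simp only: inner_commute)
    then have "(inner (K x) v)\<^sup>2 \<le> (norm x * norm (qadjoint K v))\<^sup>2"
      using Cauchy_Schwarz_ineq[of x "qadjoint K v"] by (simp add: power_mult_distrib power2_norm_eq_inner)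
    also have "\<dots> = (norm x)\<^sup>2 / A * (A * (norm (qadjoint K v))\<^sup>2)"
      using AB(1) by (simp add: power_mult_distrib)
    also have "\<dots> \<le> (norm x)\<^sup>2 / A * b v v"
      using AB(1) AB(2)[of v] b_nonneg[of v] by (intro mult_left_mono) (auto simp: b_nn ennreal_le_iff)
    finally show ?thesis .
  qed
  have lin: "linear (inner (K x))"
    by (simp add: linear_iff inner_add_right)
  have sym: "b u v = b v u" for u v
    by (simp add: b_def inner_commute)
  have C: "0 \<le> (norm x)\<^sup>2 / A"
    using AB(1) by simp
  obtain u where u: "\<And>m n. m \<le> n \<Longrightarrow> b (u m - u n) (u m - u n) \<le> (1/4) ^ m"
      "\<And>v. (\<lambda>n. b (u n) v) \<longlonglongrightarrow> inner (K x) v"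
    using riesz_minimizing_sequence[OF \<open>bilinear b\<close> sym b_nonneg lin C bound] by blast
  have "(\<integral>\<^sup>+\<omega>. ennreal ((norm (?t (u m) \<omega> - ?t (u n) \<omega>))\<^sup>2) \<partial>M) \<le> ennreal ((1/4) ^ m)" if "m \<le> n" for m n
    using u(1)[OF that] by (simp add: t_diff[symmetric] b_nn ennreal_leI)
  then obtain h where [measurable]: "h \<in> borel_measurable M"
    and h: "\<And>n. (\<integral>\<^sup>+\<omega>. ennreal ((norm (?t (u n) \<omega> - h \<omega>))\<^sup>2) \<partial>M) \<le> ennreal ((1/4) ^ n)"
    using L2_complete_fast_Cauchy[of "\<lambda>n. ?t (u n)" M] by auto
  have "(\<lambda>\<omega>. h \<omega> - ?t (u 0) \<omega>) \<in> square_integrable M"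
    using h[of 0] by (auto simp: square_integrable_def norm_minus_commute intro: le_less_trans)
  from square_integrable_add[OF this sq[of "u 0"]] have h_sq: "h \<in> square_integrable M"
    by simp
  have h_inner: "(\<integral>\<omega>. inner (h \<omega>) (?t v \<omega>) \<partial>M) = inner (K x) v" for v
  proof (rule LIMSEQ_unique)
    show "(\<lambda>n. b (u n) v) \<longlonglongrightarrow> (\<integral>\<omega>. inner (h \<omega>) (?t v \<omega>) \<partial>M)"
      unfolding b_def by (rule tendsto_integral_inner[OF sq h_sq sq h]) (auto intro: LIMSEQ_realpow_zero)
  qed (rule u(2))
  show thesis
  proof (rule that[OF L2_class_in_L2[OF h_sq]])
    fix v
    have "qinner (K x) v = (\<integral>\<omega>. qcnj (h \<omega>) * ?t v \<omega> \<partial>M)"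
    proof (rule qre_mult_eqD)
      fix q
      have "qre (qinner (K x) v * q) = inner (K x) (v *\<^sub>H q)"
        by (simp add: inner_eq_qinner qinner_scaleH_right del: quat_ring_sel)
      also have "\<dots> = qre (\<integral>\<omega>. qcnj (h \<omega>) * ?t (v *\<^sub>H q) \<omega> \<partial>M)"
        by (simp add: h_inner[symmetric] integrable_inner(2)[OF h_sq sq])
      also have "(\<integral>\<omega>. qcnj (h \<omega>) * ?t (v *\<^sub>H q) \<omega> \<partial>M) = (\<integral>\<omega>. qcnj (h \<omega>) * ?t v \<omega> \<partial>M) * q"
        using integrable_qcnj_mult[OF h_sq sq]
        by (simp add: qinner_scaleH_right mult.assoc[symmetric])
      finally show "qre (qinner (K x) v * q) = qre ((\<integral>\<omega>. qcnj (h \<omega>) * ?t v \<omega> \<partial>M) * q)" .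
    qed
    then show "qinner (K x) v = L2_inner M (L2_class M h) (transform M F v)"
      by (simp add: transform_def L2_inner_class[OF h_sq sq])
  qed
qed

section \<open>Direct sums\<close>

lemma bounded_qlinear_map_prod:
  assumes "bounded_qlinear K1" "bounded_qlinear K2"
  shows "bounded_qlinear (map_prod K1 K2)"
proof -
  obtain C1 C2 where C: "\<And>u. norm (K1 u) \<le> C1 * norm u" "\<And>u. norm (K2 u) \<le> C2 * norm u"
    using assms by (auto simp: bounded_qlinear_def)
  have "norm (map_prod K1 K2 x) \<le> (\<bar>C1\<bar> + \<bar>C2\<bar>) * norm x" for x
  proof -
    have "norm (map_prod K1 K2 x) \<le> norm (K1 (fst x)) + norm (K2 (snd x))"
      by (cases x) (simp add: norm_Pair_le)
    also have "\<dots> \<le> \<bar>C1\<bar> * norm (fst x) + \<bar>C2\<bar> * norm (snd x)"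
      by (intro add_mono order_trans[OF C(1)] order_trans[OF C(2)] mult_right_mono) auto
    also have "\<dots> \<le> \<bar>C1\<bar> * norm x + \<bar>C2\<bar> * norm x"
      by (cases x) (auto intro!: add_mono mult_left_mono simp: norm_fst_le norm_snd_le)
    finally show ?thesis
      by (simp add: distrib_right)
  qed
  then have bounded: "\<exists>C. \<forall>x. norm (map_prod K1 K2 x) \<le> C * norm x"
    by blast
  show ?thesis
    unfolding bounded_qlinear_def
    by (intro conjI bounded)
      (use assms in \<open>auto simp: bounded_qlinear_def scaleH_prod_def prod_eq_iff\<close>)
qed

theorem theorem10:
  fixes M :: "'w measure"
    and K1 :: "'a::quat_hilbert \<Rightarrow> 'a" and K2 :: "'b::quat_hilbert \<Rightarrow> 'b"
    and F1 :: "'w \<Rightarrow> 'a" and F2 :: "'w \<Rightarrow> 'b"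
  assumes "bounded_qlinear K1" and "bounded_qlinear K2"
    and "continuous_K_frame M K1 F1" and "continuous_K_frame M K2 F2"
    and "continuous_K_frame M (map_prod K1 K2) (\<lambda>\<omega>. (F1 \<omega>, F2 \<omega>))"
  shows "range K1 \<subseteq> preframe M F1 ` preframe_kernel M F2 \<and>
         range K2 \<subseteq> preframe M F2 ` preframe_kernel M F1"
proof -
  have sum: "\<exists>G\<in>L2 M. preframe M F1 G = K1 x \<and> preframe M F2 G = K2 y" for x y
  proof -
    obtain G where G: "G \<in> L2 M"
      "\<And>u. qinner (map_prod K1 K2 (x, y)) u = L2_inner M G (transform M (\<lambda>\<omega>. (F1 \<omega>, F2 \<omega>)) u)"
      using continuous_K_frame_range[OF bounded_qlinear_map_prod[OF assms(1,2)] assms(5)] by metis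
    \<comment> \<open>Vectors supported in one summand separate the two components of the pre-frame operator.\<close>
    have "qinner (K1 x) u = L2_inner M G (transform M F1 u)" for u
      using G(2)[of "(u, 0)"] by (simp add: transform_def qinner_prod_def)
    moreover have "qinner (K2 y) u = L2_inner M G (transform M F2 u)" for u
      using G(2)[of "(0, u)"] by (simp add: transform_def qinner_prod_def)
    ultimately show ?thesis
      using G(1) by (blast intro: preframe_eqI)
  qed
  have "K1 0 = 0" "K2 0 = 0"
    using assms(1,2) by (simp_all add: bounded_qlinear_imp_linear linear_0)
  have "K1 x \<in> preframe M F1 ` preframe_kernel M F2" for x
    using sum[of x 0] \<open>K2 0 = 0\<close> by (force simp: preframe_kernel_def)
  moreover have "K2 y \<in> preframe M F2 ` preframe_kernel M F1" for y
    using sum[of 0 y] \<open>K1 0 = 0\<close> by (force simp: preframe_kernel_def)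
  ultimately show ?thesis
    by blast
qed

end
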